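(* For positive integers $n,\lambda$, there exists a bipartite covering $\mathcal{H}=\{H_1,\dots,H_m\}$ of the multigraph $K_n^{\lambda}$ satisfying $${\rm cap}(\mathcal{H}) \leq n\big( \log (n-1) + (1+ o(1))\lambda \log \log n\big),$$ where $o(1)$ denotes a quantity tending to $0$ as $n\to\infty$. Moreover, if $\lambda = k\log (n-1)$ with $k\geq 1/2$, then one can further ensure $|\mathcal{H}|\leq \left(2+ \frac{30}{\sqrt{k}}\right) \lambda n$.
   Context: All logarithms are to base $2$. $K_n^{\lambda}$ denotes the complete multigraph on an $n$-element vertex set in which every pair of distinct vertices is joined by an edge of multiplicity $\lambda$. For a multigraph $G$, a bipartite covering of $G$ is a finite collection $\mathcal{H}=\{H_1,\dots,H_m\}$ of (simple) bipartite graphs with $V(H_i)\subseteq V(G)$ such that for every pair $e$ of vertices joined in $G$ with multiplicity $\mu$, there are at least $\mu$ distinct indices $i\in[m]$ with $e\in E(H_i)$. The capacity is ${\rm cap}(\mathcal{H})=\sum_{i=1}^m |H_i|$, where $|H_i|$ is the number of vertices of $H_i$; $|\mathcal{H}|=m$ is the number of graphs in the collection.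
   Formalization: The statement is taken for n ≥ 3: at n = 1 the logarithms are undefined, and at n = 2 the right-hand side is 0 while any covering has capacity at least 2λ; the o(1) is a function of n alone, uniform in λ. *)

theory Defs
  imports Complex_Main
begin

record 'a sgraph =
  verts :: "'a set"
  edges :: "'a set set"

definition simple_graph :: "'a sgraph \<Rightarrow> bool" where
  "simple_graph H \<longleftrightarrow> finite (verts H) \<and> (\<forall>e\<in>edges H. e \<subseteq> verts H \<and> card e = 2)"

definition bipartite :: "'a sgraph \<Rightarrow> bool" where
  "bipartite H \<longleftrightarrow> simple_graph H \<and>
     (\<exists>A B. A \<union> B = verts H \<and> A \<inter> B = {} \<and> (\<forall>e\<in>edges H. \<exists>a\<in>A. \<exists>b\<in>B. e = {a, b}))"

text \<open>Only the values of \<open>mult\<close> on two-element subsets of \<open>mverts\<close> are meaningful;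
  multiplicity \<open>0\<close> means that the two vertices are not joined.\<close>

record 'a multigraph =
  mverts :: "'a set"
  mult :: "'a set \<Rightarrow> nat"

definition complete_multigraph :: "'a set \<Rightarrow> nat \<Rightarrow> 'a multigraph" where
  "complete_multigraph V l =
     \<lparr>mverts = V, mult = (\<lambda>e. if e \<subseteq> V \<and> card e = 2 then l else 0)\<rparr>"

text \<open>A collection \<open>H\<^sub>1, \<dots>, H\<^sub>m\<close> is a list rather than a set: members may repeat, and
  the multiplicity with which a pair is covered counts indices.\<close>

definition bipartite_covering :: "'a multigraph \<Rightarrow> 'a sgraph list \<Rightarrow> bool" where
  "bipartite_covering G Hs \<longleftrightarrow>
     (\<forall>H\<in>set Hs. bipartite H \<and> verts H \<subseteq> mverts G) \<and>
     (\<forall>e. e \<subseteq> mverts G \<and> card e = 2 \<longrightarrow>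
        mult G e \<le> card {i. i < length Hs \<and> e \<in> edges (Hs ! i)})"

definition cap :: "'a sgraph list \<Rightarrow> nat" where
  "cap Hs = (\<Sum>i<length Hs. card (verts (Hs ! i)))"

end

theory Submission
  imports Defs "HOL-Real_Asymp.Real_Asymp"
begin

text \<open>A list of \<open>m\<close> cuts of \<open>V\<close> assigns to every vertex a binary word of length \<open>m\<close>, and covers
  each pair at least \<open>l\<close> times iff these words have pairwise Hamming distance at least \<open>l\<close>; its
  capacity is \<open>n m\<close>. By the Gilbert--Varshamov argument such words exist as soon as \<open>n - 1\<close> Hamming
  balls of radius \<open>l - 1\<close> do not fill the cube. The volume of such a ball is at most
  \<open>(1 + x)^m / x^l\<close> for every \<open>0 < x \<le> 1\<close>, and \<open>x = 1 / log n\<close> shows that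
  \<open>m = log (n - 1) + l log log n + O(l + l log log n / log n)\<close> suffices.
  The bounded values of \<open>n\<close> are handled by taking each star \<open>l\<close> times.\<close>

definition cut_graph :: "'a set \<Rightarrow> 'a set \<Rightarrow> 'a sgraph" where
  "cut_graph V S = \<lparr>verts = V, edges = {{a, b} |a b. a \<in> V \<inter> S \<and> b \<in> V - S}\<rparr>"

lemma bipartite_cut_graph:
  assumes "finite V"
  shows "bipartite (cut_graph V S)"
proof -
  have "simple_graph (cut_graph V S)"
    using assms by (auto simp: simple_graph_def cut_graph_def card_2_iff)
  moreover have "\<exists>A B. A \<union> B = V \<and> A \<inter> B = {} \<and>
      (\<forall>e\<in>edges (cut_graph V S). \<exists>a\<in>A. \<exists>b\<in>B. e = {a, b})"
    by (rule exI[of _ "V \<inter> S"], rule exI[of _ "V - S"]) (auto simp: cut_graph_def)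
  ultimately show ?thesis
    by (simp add: bipartite_def cut_graph_def)
qed

lemma bipartite_covering_cut_graphs:
  assumes "finite V"
    and sep: "\<And>u v. u \<in> V \<Longrightarrow> v \<in> V \<Longrightarrow> u \<noteq> v \<Longrightarrow>
      l \<le> card {i. i < m \<and> (u \<in> S i) \<noteq> (v \<in> S i)}"
  shows "bipartite_covering (complete_multigraph V l) (map (\<lambda>i. cut_graph V (S i)) [0..<m])"
proof -
  have "l \<le> card {i. i < m \<and> e \<in> edges (cut_graph V (S i))}"
    if e: "e \<subseteq> V" "card e = 2" for e
  proof -
    obtain u v where uv: "e = {u, v}" "u \<noteq> v"
      using e(2) by (auto simp: card_2_iff)
    then have "{i. i < m \<and> (u \<in> S i) \<noteq> (v \<in> S i)} \<subseteq> {i. i < m \<and> e \<in> edges (cut_graph V (S i))}"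
      using e(1) by (auto simp: cut_graph_def)
    then have "card {i. i < m \<and> (u \<in> S i) \<noteq> (v \<in> S i)} \<le> card {i. i < m \<and> e \<in> edges (cut_graph V (S i))}"
      by (intro card_mono) auto
    then show ?thesis
      using sep[of u v] uv e(1) by auto
  qed
  then show ?thesis
    using assms(1)
    by (auto simp: bipartite_covering_def complete_multigraph_def bipartite_cut_graph
        cut_graph_def[THEN arg_cong[where f = verts]] cong: conj_cong)
qed

lemma cap_cut_graphs: "cap (map (\<lambda>i. cut_graph V (S i)) [0..<m]) = m * card V"
  by (simp add: cap_def cut_graph_def)

lemma star_cuts_separate:
  assumes "finite V"
  obtains S :: "nat \<Rightarrow> 'a set" where
    "\<And>u v. u \<in> V \<Longrightarrow> v \<in> V \<Longrightarrow> u \<noteq> v \<Longrightarrow>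
      l \<le> card {i. i < l * card V \<and> (u \<in> S i) \<noteq> (v \<in> S i)}"
proof -
  obtain xs where xs: "set xs = V" "length xs = card V"
    using assms by (metis finite_distinct_list distinct_card)
  define n where "n = card V"
  define S where "S i = {xs ! (i mod n)}" for i
  have "l \<le> card {i. i < l * n \<and> (u \<in> S i) \<noteq> (v \<in> S i)}" if uv: "u \<in> V" "v \<in> V" "u \<noteq> v" for u v
  proof -
    obtain j where j: "j < n" "u = xs ! j"
      using uv(1) xs unfolding n_def by (metis in_set_conv_nth)
    have "j + n * t < l * n" if "t < l" for t
    proof -
      have "j + n * t < n * Suc t" using j(1) by simp
      also have "\<dots> \<le> n * l" using that by (intro mult_le_mono2) simp
      finally show ?thesis by (simp add: mult.commute)
    qed
    then have "(\<lambda>t. j + n * t) ` {..<l} \<subseteq> {i. i < l * n \<and> (u \<in> S i) \<noteq> (v \<in> S i)}"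
      using j uv(3) by (auto simp: S_def)
    then have "card ((\<lambda>t. j + n * t) ` {..<l}) \<le> card {i. i < l * n \<and> (u \<in> S i) \<noteq> (v \<in> S i)}"
      by (intro card_mono) auto
    moreover have "inj_on (\<lambda>t. j + n * t) {..<l}"
      using j(1) by (auto simp: inj_on_def)
    ultimately show ?thesis by (simp add: card_image)
  qed
  then show thesis using that[of S] unfolding n_def by blast
qed

lemma gilbert_varshamov:
  fixes V :: "'a set" and m l :: nat
  assumes "finite V" and "(card V - 1) * card {D. D \<subseteq> {..<m} \<and> card D < l} < 2 ^ m"
  shows "\<exists>c. \<forall>u\<in>V. c u \<subseteq> {..<m} \<and> (\<forall>v\<in>V. u \<noteq> v \<longrightarrow> l \<le> card (sym_diff (c u) (c v)))"
  using assms
proof (induction V rule: finite_induct)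
  case empty
  then show ?case by simp
next
  case (insert a F)
  define W where "W = {D. D \<subseteq> {..<m} \<and> card D < l}"
  have lt: "card F * card W < 2 ^ m"
    using insert by (simp add: W_def)
  moreover have "(card F - 1) * card W \<le> card F * card W"
    by (intro mult_le_mono1) simp
  ultimately have "(card F - 1) * card W < 2 ^ m" by linarith
  then obtain c where c: "\<forall>u\<in>F. c u \<subseteq> {..<m} \<and> (\<forall>v\<in>F. u \<noteq> v \<longrightarrow> l \<le> card (sym_diff (c u) (c v)))"
    using insert.IH unfolding W_def by blast
  have "finite W" by (auto simp: W_def)
  let ?U = "\<Union>u\<in>F. sym_diff (c u) ` W"
  have "card ?U \<le> (\<Sum>u\<in>F. card (sym_diff (c u) ` W))"
    using insert.hyps by (intro card_UN_le)
  also have "\<dots> \<le> (\<Sum>u\<in>F. card W)"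
    using \<open>finite W\<close> by (intro sum_mono card_image_le)
  also have "\<dots> < card (Pow {..<m})"
    using lt by (simp add: card_Pow)
  finally have "\<not> Pow {..<m} \<subseteq> ?U"
    using \<open>finite W\<close> insert.hyps by (meson card_mono finite_UN_I finite_imageI linorder_not_le)
  then obtain T where T: "T \<subseteq> {..<m}" "T \<notin> ?U" by blast
  have far: "l \<le> card (sym_diff (c u) T)" if "u \<in> F" for u
  proof (rule ccontr)
    assume "\<not> ?thesis"
    then have "sym_diff (c u) T \<in> W"
      using c T(1) that by (auto simp: W_def)
    moreover have "T = sym_diff (c u) (sym_diff (c u) T)" by auto
    ultimately show False using T(2) that by blast
  qed
  have "\<forall>u\<in>insert a F. (c(a := T)) u \<subseteq> {..<m} \<and>
      (\<forall>v\<in>insert a F. u \<noteq> v \<longrightarrow> l \<le> card (sym_diff ((c(a := T)) u) ((c(a := T)) v)))"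
    using c T(1) far insert.hyps(2) by (auto simp: Un_commute)
  then show ?case by blast
qed

lemma hamming_ball_volume:
  fixes x :: real
  assumes "0 < x" "x \<le> 1"
  shows "x ^ l * real (card {D. D \<subseteq> {..<m} \<and> card D < l}) \<le> (1 + x) ^ m"
proof -
  let ?W = "{D. D \<subseteq> {..<m} \<and> card D < l}"
  have "x ^ l * real (card ?W) = (\<Sum>D\<in>?W. x ^ l)" by simp
  also have "\<dots> \<le> (\<Sum>D\<in>?W. x ^ card D)"
    using assms by (intro sum_mono power_decreasing) auto
  also have "\<dots> \<le> (\<Sum>D\<in>Pow {..<m}. x ^ card D)"
    using assms by (intro sum_mono2) auto
  also have "\<dots> = (\<Prod>i<m. x + 1)"
    by (subst prod_add) auto
  finally show ?thesis by (simp add: add.commute)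
qed

lemma log2_one_plus_le: "log 2 (1 + x) \<le> 2 * x" if "0 \<le> x" for x :: real
proof -
  have "ln (1 + x) \<le> x" using that by (rule ln_add_one_self_le_self)
  moreover have "1 / 2 \<le> ln (2::real)" using ln_le_minus_one[of "1 / 2 :: real"] by (simp add: ln_div)
  then have "x * 1 \<le> x * (2 * ln 2)" using that by (intro mult_left_mono) auto
  ultimately have "ln (1 + x) \<le> 2 * x * ln 2" by linarith
  then show ?thesis by (simp add: log_def divide_le_eq)
qed

lemma gilbert_varshamov_cuts:
  fixes V :: "'a set" and n l m :: nat
  assumes "finite V" "card V = n" "n \<ge> 16"
    and m: "m * (1 - 2 / log 2 n) > log 2 (real n - 1) + l * log 2 (log 2 n)"
  obtains S :: "nat \<Rightarrow> 'a set" where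
    "\<And>u v. u \<in> V \<Longrightarrow> v \<in> V \<Longrightarrow> u \<noteq> v \<Longrightarrow> l \<le> card {i. i < m \<and> (u \<in> S i) \<noteq> (v \<in> S i)}"
proof -
  define W where "W = {D::nat set. D \<subseteq> {..<m} \<and> card D < l}"
  define y where "y = log 2 (real n)"
  have "log 2 (2 ^ 4) \<le> y" unfolding y_def using assms(3) by (intro log_mono) auto
  then have y4: "y \<ge> 4" by (subst (asm) log_pow_cancel) auto
  have "(1 / y) ^ l * real (card W) \<le> (1 + 1 / y) ^ m"
    unfolding W_def using y4 by (intro hamming_ball_volume) auto
  then have W: "real (card W) \<le> (1 + 1 / y) ^ m * y ^ l"
    using y4 by (simp add: field_simps)
  have y1: "1 + 1 / y > 0" using y4 by (intro add_pos_pos) auto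
  have "log 2 ((real n - 1) * ((1 + 1 / y) ^ m * y ^ l))
      = log 2 (real n - 1) + m * log 2 (1 + 1 / y) + l * log 2 y"
    using y4 y1 assms(3) by (simp add: log_mult log_nat_power)
  also have "\<dots> \<le> log 2 (real n - 1) + m * (2 * (1 / y)) + l * log 2 y"
    using log2_one_plus_le[of "1 / y"] y4 by (intro add_mono mult_left_mono) auto
  also have "\<dots> < m"
    using m by (simp add: y_def algebra_simps)
  finally have "(real n - 1) * ((1 + 1 / y) ^ m * y ^ l) < 2 powr m"
    using y4 y1 assms(3) by (subst (asm) log_less_iff) auto
  moreover have "(real n - 1) * real (card W) \<le> (real n - 1) * ((1 + 1 / y) ^ m * y ^ l)"
    using W assms(3) by (intro mult_left_mono) auto
  ultimately have "(real n - 1) * real (card W) < 2 powr m" by linarith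
  then have "real ((n - 1) * card W) < real (2 ^ m)"
    using assms(3) by (simp add: powr_realpow of_nat_diff)
  then have "(card V - 1) * card W < 2 ^ m"
    unfolding assms(2) by (rule of_nat_less_imp_less)
  from gilbert_varshamov[OF assms(1) this[unfolded W_def]] obtain c where
    c: "\<forall>u\<in>V. c u \<subseteq> {..<m} \<and> (\<forall>v\<in>V. u \<noteq> v \<longrightarrow> l \<le> card (sym_diff (c u) (c v)))"
    by blast
  have "{i. i < m \<and> (u \<in> {w. i \<in> c w}) \<noteq> (v \<in> {w. i \<in> c w})} = sym_diff (c u) (c v)"
    if "u \<in> V" "v \<in> V" for u v
    using c that by auto
  then show thesis
    using c by (intro that[of "\<lambda>i. {w. i \<in> c w}"]) auto
qed

definition covering_error :: "nat \<Rightarrow> real" where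
  "covering_error n =
     (if n < 16 then n / log 2 (log 2 n) else 5 / log 2 (log 2 n) + 4 / log 2 n)"

lemma covering_error_tendsto_0: "covering_error \<longlonglongrightarrow> 0"
proof -
  have "(\<lambda>n::nat. 5 / log 2 (log 2 n) + 4 / log 2 n) \<longlonglongrightarrow> 0"
    by real_asymp
  moreover have "\<forall>\<^sub>F n in sequentially. 5 / log 2 (log 2 n) + 4 / log 2 n = covering_error n"
    using eventually_ge_at_top[of 16] by eventually_elim (simp add: covering_error_def)
  ultimately show ?thesis
    by (rule Lim_transform_eventually)
qed

text \<open>A single covering meets both bounds: \<open>l = k log (n - 1)\<close> with \<open>k \<ge> 1/2\<close> only enters through
  \<open>log (n - 1) \<le> 2 l\<close>.\<close>

lemma exists_small_covering:
  fixes V :: "'a set" and n l :: nat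
  assumes "finite V" "card V = n" "n \<ge> 3" "l \<ge> 1"
  shows "\<exists>Hs. bipartite_covering (complete_multigraph V l) Hs \<and>
    real (cap Hs) \<le> n * (log 2 (real n - 1) + (1 + covering_error n) * l * log 2 (log 2 n)) \<and>
    (log 2 (real n - 1) \<le> 2 * real l \<longrightarrow> length Hs \<le> 2 * l * n)"
proof (cases "n < 16")
  case True
  obtain S :: "nat \<Rightarrow> 'a set" where
    "\<And>u v. u \<in> V \<Longrightarrow> v \<in> V \<Longrightarrow> u \<noteq> v \<Longrightarrow> l \<le> card {i. i < l * card V \<and> (u \<in> S i) \<noteq> (v \<in> S i)}"
    using star_cuts_separate[OF assms(1)] by blast
  note cov = bipartite_covering_cut_graphs[OF assms(1) this]
  have "log 2 2 < log 2 (real n)" using assms(3) by (subst log_less_cancel_iff) auto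
  then have L: "log 2 (log 2 (real n)) > 0" by simp
  have "0 \<le> log 2 (real n - 1)" using assms(3) by simp
  moreover have "(1 + covering_error n) * l * log 2 (log 2 n) = l * log 2 (log 2 n) + l * n"
    using L True by (simp add: covering_error_def field_simps)
  moreover have "0 \<le> l * log 2 (log 2 (real n))" using L by simp
  ultimately have "n * real (l * n) \<le>
      n * (log 2 (real n - 1) + (1 + covering_error n) * l * log 2 (log 2 n))"
    by (intro mult_left_mono) auto
  then show ?thesis
    using cov unfolding assms(2)
    by (intro exI[of _ "map (\<lambda>i. cut_graph V (S i)) [0..<l * n]"])
      (simp add: cap_cut_graphs assms(2) mult_ac)
next
  case False
  define y where "y = log 2 (real n)"
  define L where "L = log 2 y"
  define z where "z = log 2 (real n - 1)"
  have "log 2 (2 ^ 4) \<le> y" unfolding y_def using False by (intro log_mono) auto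
  then have y4: "y \<ge> 4" by (subst (asm) log_pow_cancel) auto
  have "log 2 (2 ^ 2) \<le> L" unfolding L_def using y4 by (intro log_mono) auto
  then have L2: "L \<ge> 2" by (subst (asm) log_pow_cancel) auto
  have "z \<ge> 0" "z \<le> y" unfolding z_def y_def using False by (auto intro!: log_mono)
  have "y < n" unfolding y_def using log2_of_power_less[of n n] False by simp
  have "L \<le> y"
    unfolding L_def using y4 \<open>y < n\<close> unfolding y_def by (intro log_mono) auto
  define b where "b = z + l * L + 4 + 4 / y * l * L"
  have "b \<ge> 0" unfolding b_def using \<open>z \<ge> 0\<close> L2 y4 by auto
  define m where "m = nat \<lfloor>b\<rfloor> + 1"
  have mb: "real m > b" "real m \<le> b + 1" unfolding m_def using \<open>b \<ge> 0\<close> by linarith+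
  have "z + l * L \<le> b * (1 - 2 / y)"
  proof -
    define x where "x = 1 / y"
    have x: "0 < x" "x \<le> 1 / 4" unfolding x_def using y4 by (auto simp: field_simps)
    have "z * x \<le> 1" unfolding x_def using \<open>z \<le> y\<close> y4 by simp
    moreover have "b = z + l * L + 4 + 4 * x * l * L" by (simp add: b_def x_def)
    ultimately have "(z + l * L) * (1 + 4 * x) \<le> b" by (simp add: algebra_simps)
    then have "(z + l * L) * (1 + 4 * x) * (1 - 2 * x) \<le> b * (1 - 2 * x)"
      using x by (intro mult_right_mono) auto
    moreover have "0 \<le> 2 * x * (1 - 4 * x)" using x by (intro mult_nonneg_nonneg) auto
    then have "1 \<le> (1 + 4 * x) * (1 - 2 * x)" by (simp add: algebra_simps)
    then have "(z + l * L) * 1 \<le> (z + l * L) * ((1 + 4 * x) * (1 - 2 * x))"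
      using \<open>z \<ge> 0\<close> L2 by (intro mult_left_mono) auto
    ultimately show ?thesis by (simp add: x_def mult.assoc)
  qed
  also have "\<dots> < m * (1 - 2 / y)"
    using mb(1) y4 by (intro mult_strict_right_mono) auto
  finally have "m * (1 - 2 / y) > z + l * L" .
  then obtain S :: "nat \<Rightarrow> 'a set" where
    "\<And>u v. u \<in> V \<Longrightarrow> v \<in> V \<Longrightarrow> u \<noteq> v \<Longrightarrow> l \<le> card {i. i < m \<and> (u \<in> S i) \<noteq> (v \<in> S i)}"
    using gilbert_varshamov_cuts[OF assms(1,2), of l m] False
    unfolding z_def L_def y_def by force
  note cov = bipartite_covering_cut_graphs[OF assms(1) this]
  have l1: "real l \<ge> 1" using assms(4) by simp
  have err: "(1 + covering_error n) * l * L = l * L + 5 * l + 4 / y * l * L"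
    using L2 y4 False by (simp add: covering_error_def L_def y_def field_simps)
  have le: "real m \<le> z + (1 + covering_error n) * l * L"
    using mb(2) l1 unfolding err b_def by linarith
  have "m \<le> 2 * l * n" if "z \<le> 2 * real l"
  proof -
    have "4 * L / y \<le> 4" using \<open>L \<le> y\<close> y4 by (simp add: divide_le_eq)
    then have "real l * (2 + L + 5 + 4 * L / y) \<le> real l * (2 * n)"
      using \<open>L \<le> y\<close> \<open>y < n\<close> False by (intro mult_left_mono) auto
    moreover have "real m \<le> real l * (2 + L + 5 + 4 * L / y)"
      using le that unfolding err by (simp add: algebra_simps)
    ultimately have "real m \<le> real (2 * l * n)" by (simp add: mult_ac)
    then show ?thesis by (simp only: of_nat_le_iff)
  qed
  moreover have "real (m * n) \<le> n * (z + (1 + covering_error n) * l * L)"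
    using mult_left_mono[OF le, of "real n"] by (simp add: mult_ac)
  ultimately show ?thesis
    using cov unfolding z_def L_def y_def
    by (intro exI[of _ "map (\<lambda>i. cut_graph V (S i)) [0..<m]"]) (simp add: cap_cut_graphs assms(2))
qed

theorem theorem1p4:
  "\<exists>\<epsilon> :: nat \<Rightarrow> real. \<epsilon> \<longlonglongrightarrow> 0 \<and>
     (\<forall>(n::nat) (l::nat) (V :: 'a set). n \<ge> 3 \<and> l \<ge> 1 \<and> finite V \<and> card V = n \<longrightarrow>
        (\<exists>Hs. bipartite_covering (complete_multigraph V l) Hs \<and>
           real (cap Hs) \<le> real n * (log 2 (real n - 1) + (1 + \<epsilon> n) * real l * log 2 (log 2 (real n)))) \<and>
        (\<forall>k::real. k \<ge> 1 / 2 \<and> real l = k * log 2 (real n - 1) \<longrightarrow>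
           (\<exists>Hs. bipartite_covering (complete_multigraph V l) Hs \<and>
              real (cap Hs) \<le> real n * (log 2 (real n - 1) + (1 + \<epsilon> n) * real l * log 2 (log 2 (real n))) \<and>
              real (length Hs) \<le> (2 + 30 / sqrt k) * real l * real n)))"
proof (rule exI[of _ covering_error], intro conjI allI impI covering_error_tendsto_0)
  fix n l :: nat and V :: "'a set"
  assume "n \<ge> 3 \<and> l \<ge> 1 \<and> finite V \<and> card V = n"
  then obtain Hs where Hs: "bipartite_covering (complete_multigraph V l) Hs"
    "real (cap Hs) \<le> n * (log 2 (real n - 1) + (1 + covering_error n) * l * log 2 (log 2 n))"
    "log 2 (real n - 1) \<le> 2 * real l \<longrightarrow> length Hs \<le> 2 * l * n" and n: "n \<ge> 3"
    using exists_small_covering[of V n l] by blast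
  show "\<exists>Hs. bipartite_covering (complete_multigraph V l) Hs \<and>
      real (cap Hs) \<le> real n * (log 2 (real n - 1) + (1 + covering_error n) * real l * log 2 (log 2 (real n)))"
    using Hs by blast
  fix k :: real
  assume k: "k \<ge> 1 / 2 \<and> real l = k * log 2 (real n - 1)"
  have "0 \<le> log 2 (real n - 1)" using n by simp
  then have "1 / 2 * log 2 (real n - 1) \<le> real l"
    using k by (metis mult_right_mono)
  then have "length Hs \<le> 2 * l * n" using Hs(3) by simp
  then have "real (length Hs) \<le> 2 * real l * real n"
    by (metis of_nat_le_iff of_nat_mult of_nat_numeral)
  also have "\<dots> \<le> (2 + 30 / sqrt k) * real l * real n"
    using k by (intro mult_right_mono) auto
  finally show "\<exists>Hs. bipartite_covering (complete_multigraph V l) Hs \<and>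
      real (cap Hs) \<le> real n * (log 2 (real n - 1) + (1 + covering_error n) * real l * log 2 (log 2 (real n))) \<and>
      real (length Hs) \<le> (2 + 30 / sqrt k) * real l * real n"
    using Hs by blast
qed

end
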